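(* For a Tychonoff space $X$, the following assertions are equivalent: (i) $X$ is a $\kappa$-Fréchet--Urysohn space; (ii) the natural inclusion map $I:\bigoplus\mathcal{S}(X)\to X$ is a $\kappa$-pseudo open map; (iii) $X$ is the image of some metrizable locally compact space under a $\kappa$-pseudo open map; (iv) $X$ is the image of some Fréchet--Urysohn space under a $\kappa$-pseudo open map.
   Context: All topological spaces are assumed to be Tychonoff. $\mathcal{S}(X)$ is the family of all convergent sequences in $X$ with their limit points, i.e. all subspaces $S=\{x_n\}_{n\in\omega}\cup\{x\}$ of $X$ with $x_n\to x$ (constant sequences allowed); $\bigoplus\mathcal{S}(X)=\bigoplus_{S\in\mathcal{S}(X)}S$ is their topological sum (disjoint union), and $I$ is the map whose restriction to each summand $S$ is the inclusion $S\hookrightarrow X$. A space $X$ is $\kappa$-Fréchet--Urysohn if for every open $U\subseteq X$ and every $x\in\overline{U}$ there is a sequence $\{x_n\}_{n\in\omega}\subseteq U$ converging to $x$; it is Fréchet--Urysohn if for every $A\subseteq X$ and every $a\in\overline{A}\setminus A$ there is a sequence in $A$ converging to $a$. A continuous surjective map $f:X\to Y$ is called $\kappa$-pseudo open if whenever $y\in Y$, $U$ is open in $X$ and $f^{-1}(y)\subseteq U$, then $y\in\operatorname{Int}\big(\overline{f(U)}\big)$. *)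

theory Defs
  imports "HOL-Analysis.Analysis"
begin

definition tychonoff_space :: "'a topology \<Rightarrow> bool" where
  "tychonoff_space X \<longleftrightarrow> completely_regular_space X \<and> Hausdorff_space X"

(* Convergent sequences are represented as sets of points (range plus limit), not as functions, so
   each such subspace occurs exactly once as a summand below. *)
definition convergent_seqs :: "'a topology \<Rightarrow> 'a set set" where
  "convergent_seqs X =
     {insert x (range s) | (s :: nat \<Rightarrow> 'a) x. range s \<subseteq> topspace X \<and> limitin X s x sequentially}"

(* The points are the pairs (S, x) with x in S, so the natural map I is snd. *)
definition seq_sum :: "'a topology \<Rightarrow> ('a set \<times> 'a) topology" where
  "seq_sum X = sum_topology (subtopology X) (convergent_seqs X)"

definition kappa_Frechet_Urysohn_space :: "'a topology \<Rightarrow> bool" where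
  "kappa_Frechet_Urysohn_space X \<longleftrightarrow>
     (\<forall>U x. openin X U \<and> x \<in> X closure_of U \<longrightarrow>
        (\<exists>s :: nat \<Rightarrow> 'a. range s \<subseteq> U \<and> limitin X s x sequentially))"

definition Frechet_Urysohn_space :: "'a topology \<Rightarrow> bool" where
  "Frechet_Urysohn_space X \<longleftrightarrow>
     (\<forall>A a. A \<subseteq> topspace X \<and> a \<in> X closure_of A - A \<longrightarrow>
        (\<exists>s :: nat \<Rightarrow> 'a. range s \<subseteq> A \<and> limitin X s a sequentially))"

definition kappa_pseudo_open_map :: "'a topology \<Rightarrow> 'b topology \<Rightarrow> ('a \<Rightarrow> 'b) \<Rightarrow> bool" where
  "kappa_pseudo_open_map X Y f \<longleftrightarrow>
     continuous_map X Y f \<and> f ` topspace X = topspace Y \<and>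
     (\<forall>y U. y \<in> topspace Y \<and> openin X U \<and> {x \<in> topspace X. f x = y} \<subseteq> U \<longrightarrow>
        y \<in> Y interior_of (Y closure_of (f ` U)))"

end

theory Submission
  imports Defs
begin

text \<open>
  For (i) \<open>\<Longrightarrow>\<close> (ii), if \<open>y\<close> were not interior to the closure of the image of \<open>U\<close>, some sequence
  in the open complement of that closure would converge to \<open>y\<close>; as a summand of the topological sum it
  is eventually in \<open>U\<close>, a contradiction. For (iv) \<open>\<Longrightarrow>\<close> (i), if \<open>x\<close> lies in the closure of the
  open set \<open>U\<close>, the closure of the preimage of \<open>U\<close> meets the fibre over \<open>x\<close>, since otherwise its
  complement would contradict \<open>\<kappa>\<close>-pseudo openness; a sequence in the preimage converging to a point
  of the fibre maps to the desired sequence. The remaining point is that a convergent sequence in a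
  Hausdorff space embeds in the real line.
\<close>

section \<open>Metrizability of topological sums\<close>

text \<open>Truncate the metric of each summand at 1 and put points of different summands at
  distance 1. Truncation does not change small balls, and a ball of radius at most 1 stays inside
  its summand.\<close>

lemma metrizable_space_sum_topology:
  assumes "\<And>i. i \<in> I \<Longrightarrow> metrizable_space (X i)"
  shows "metrizable_space (sum_topology X I)"
proof -
  have "\<exists>d. Metric_space (topspace (X i)) d \<and> X i = Metric_space.mtopology (topspace (X i)) d"
    if "i \<in> I" for i
    using assms[OF that] unfolding metrizable_space_def
    by (metis Metric_space.topspace_mtopology)
  then obtain d where met: "\<And>i. i \<in> I \<Longrightarrow> Metric_space (topspace (X i)) (d i)"
    and top: "\<And>i. i \<in> I \<Longrightarrow> X i = Metric_space.mtopology (topspace (X i)) (d i)"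
    by metis
  \<comment> \<open>The test \<open>i \<in> I\<close> matters because \<open>Metric_space\<close>
    demands nonnegativity and symmetry for all pairs, also outside the carrier, while
    \<open>d i\<close> is known to be a metric only for \<open>i \<in> I\<close>.\<close>
  define D where "D = (\<lambda>(i, x) (j, y). if i = j \<and> i \<in> I then min 1 (d i x y) else (1 :: real))"
  have D_eq: "D (i, x) (j, y) = (if i = j \<and> i \<in> I then min 1 (d i x y) else 1)" for i x j y
    by (simp add: D_def)
  have tri: "min 1 (d i x z) \<le> min 1 (d i x y) + min 1 (d i y z)"
    if "i \<in> I" "x \<in> topspace (X i)" "y \<in> topspace (X i)" "z \<in> topspace (X i)" for i x y z
    using Metric_space.triangle[OF met[OF that(1)] that(2-4)]
      Metric_space.nonneg[OF met[OF that(1)], of x y] Metric_space.nonneg[OF met[OF that(1)], of y z]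
    by linarith
  have nn: "0 \<le> D p q" for p q
    by (auto simp: D_def Metric_space.nonneg[OF met] split: prod.split)
  interpret D: Metric_space "Sigma I (topspace \<circ> X)" D
  proof
    show "0 \<le> D p q" for p q
      by (rule nn)
    show "D p q = D q p" for p q
      by (auto simp: D_def Metric_space.commute[OF met] split: prod.split)
    show "D p q = 0 \<longleftrightarrow> p = q"
      if "p \<in> Sigma I (topspace \<circ> X)" "q \<in> Sigma I (topspace \<circ> X)" for p q
      using that by (auto simp: D_def min_def Metric_space.zero[OF met] Metric_space.mdist_zero[OF met] split: if_splits)
    show "D p r \<le> D p q + D q r"
      if "p \<in> Sigma I (topspace \<circ> X)" "q \<in> Sigma I (topspace \<circ> X)" "r \<in> Sigma I (topspace \<circ> X)"
      for p q r
    proof -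
      obtain i x j y k z where p: "p = (i, x)" and q: "q = (j, y)" and r: "r = (k, z)"
        by (metis surj_pair)
      \<comment> \<open>As soon as two consecutive points lie in different summands, their distance
        is already 1, the largest value of \<open>D\<close>.\<close>
      consider "i = j" "j = k" | "i \<noteq> j" | "j \<noteq> k"
        by blast
      then show ?thesis
      proof cases
        case 1
        then show ?thesis
          using that p q r tri by (simp add: D_def)
      next
        case 2
        then have "D p q = 1"
          by (simp add: D_def p q)
        moreover have "D p r \<le> 1"
          by (auto simp: D_def p r)
        ultimately show ?thesis
          using nn[of q r] by linarith
      next
        case 3
        then have "D q r = 1"
          by (simp add: D_def q r)
        moreover have "D p r \<le> 1"
          by (auto simp: D_def p r)
        ultimately show ?thesis
          using nn[of p q] by linarith
      qed
    qed
  qed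
  have "openin (sum_topology X I) U \<longleftrightarrow> openin D.mtopology U" for U
  proof -
    have slice: "openin (X i) {x. (i, x) \<in> U} \<longleftrightarrow>
        (\<forall>x. (i, x) \<in> U \<longrightarrow> (\<exists>r>0. D.mball (i, x) r \<subseteq> U))"
      if i: "i \<in> I" and U: "U \<subseteq> Sigma I (topspace \<circ> X)" for i
    proof -
      interpret M: Metric_space "topspace (X i)" "d i"
        by (rule met[OF i])
      have "(\<exists>r>0. M.mball x r \<subseteq> {x. (i, x) \<in> U}) \<longleftrightarrow> (\<exists>r>0. D.mball (i, x) r \<subseteq> U)" for x
      proof
        assume "\<exists>r>0. M.mball x r \<subseteq> {x. (i, x) \<in> U}"
        then obtain r where "r > 0" and r: "M.mball x r \<subseteq> {x. (i, x) \<in> U}"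
          by blast
        \<comment> \<open>Radius at most 1 excludes the other summands and makes \<open>D\<close>
          agree with \<open>d i\<close> on the ball. The converse direction can keep
          \<open>r\<close>, as truncation only decreases distances.\<close>
        have "D.mball (i, x) (min 1 r) \<subseteq> U"
          using r i by (auto simp: D_eq subset_iff split: if_splits)
        moreover have "0 < min 1 r"
          using \<open>r > 0\<close> by simp
        ultimately show "\<exists>r>0. D.mball (i, x) r \<subseteq> U"
          by blast
      next
        assume "\<exists>r>0. D.mball (i, x) r \<subseteq> U"
        then obtain r where "r > 0" and r: "D.mball (i, x) r \<subseteq> U"
          by blast
        have "M.mball x r \<subseteq> {x. (i, x) \<in> U}"
          using r i by (auto simp: D_eq subset_iff)
        with \<open>r > 0\<close> show "\<exists>r>0. M.mball x r \<subseteq> {x. (i, x) \<in> U}"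
          by blast
      qed
      moreover have "openin (X i) {x. (i, x) \<in> U} \<longleftrightarrow> openin M.mtopology {x. (i, x) \<in> U}"
        using arg_cong[OF top[OF i], of "\<lambda>T. openin T {x. (i, x) \<in> U}"] .
      moreover have "{x. (i, x) \<in> U} \<subseteq> topspace (X i)"
        using U by auto
      ultimately show ?thesis
        by (simp add: M.openin_mtopology)
    qed
    show ?thesis
    proof (cases "U \<subseteq> Sigma I (topspace \<circ> X)")
      case True
      then have "(\<forall>i\<in>I. \<forall>x. (i, x) \<in> U \<longrightarrow> P (i, x)) \<longleftrightarrow> (\<forall>p. p \<in> U \<longrightarrow> P p)" for P
        by auto
      with True show ?thesis
        by (simp add: openin_sum_topology D.openin_mtopology slice)
    next
      case False
      then show ?thesis
        by (simp add: openin_sum_topology D.openin_mtopology)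
    qed
  qed
  then have "sum_topology X I = D.mtopology"
    by (simp add: topology_eq)
  then show ?thesis
    by (simp add: D.metrizable_space_mtopology)
qed

section \<open>Convergent sequences as compact metrizable subspaces\<close>

lemma compactin_convergent_seq:
  "S \<in> convergent_seqs X \<Longrightarrow> compactin X S"
  unfolding convergent_seqs_def by (auto intro: compactin_sequence_with_limit)

text \<open>A continuous injection of a compact space into the Hausdorff real line is an embedding,
  so metrizability is inherited from the line.\<close>

lemma metrizable_space_convergent_seq:
  assumes X: "Hausdorff_space X" and "S \<in> convergent_seqs X"
  shows "metrizable_space (subtopology X S)"
proof -
  obtain s x where S: "S = insert x (range s)" and s: "range s \<subseteq> topspace X"
    and lim: "limitin X s x sequentially"
    using assms(2) unfolding convergent_seqs_def by blast
  have SX: "S \<subseteq> topspace X"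
    using S s limitin_topspace[OF lim] by blast
  \<comment> \<open>The least index makes the value independent of repetitions in \<open>s\<close>;
    \<open>Suc\<close> keeps it positive, so only the limit \<open>x\<close> is sent to 0.\<close>
  define w where "w p = (if p = x then 0 else inverse (real (Suc (LEAST n. s n = p))))" for p
  have least: "s (LEAST n. s n = p) = p" if "p \<in> S" "p \<noteq> x" for p
    using that S by (metis (mono_tags, lifting) LeastI imageE insertE)
  have "continuous_map (subtopology X S) euclideanreal w"
    unfolding continuous_map_closedin
  proof (intro conjI ballI allI impI)
    fix C :: "real set"
    assume "closedin euclideanreal C"
    then have C: "closed C"
      by simp
    let ?T = "{p \<in> topspace (subtopology X S). w p \<in> C}"
    have T: "?T = {p \<in> S. w p \<in> C}"
      using SX by auto
    have "closedin X ?T"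
    proof (cases "0 \<in> C")
      case True
      \<comment> \<open>The preimage contains the limit. Any set of terms together with the limit is
        compact, hence closed in the Hausdorff space \<open>X\<close>.\<close>
      then have "?T = insert x ({p \<in> S. w p \<in> C} - {x})"
        unfolding T using S by (auto simp: w_def)
      also have "compactin X \<dots>"
        using lim s S by (intro compactin_sequence_with_limit) auto
      finally show ?thesis
        using X by (rule compactin_imp_closedin[rotated])
    next
      case False
      \<comment> \<open>Here \<open>C\<close> stays away from 0, which bounds the least indices of
        points in the preimage, so the preimage is finite.\<close>
      then obtain e where "e > 0" and e: "\<And>y. dist y 0 < e \<Longrightarrow> y \<notin> C"
        using C by (metis Compl_iff open_Compl open_dist)
      obtain N where N: "inverse (real (Suc N)) < e"
        using reals_Archimedean[OF \<open>e > 0\<close>] by blast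
      have "?T \<subseteq> s ` {..N}"
      proof
        fix p
        assume "p \<in> ?T"
        then have p: "p \<in> S" "w p \<in> C"
          unfolding T by auto
        then have "p \<noteq> x"
          using False by (auto simp: w_def)
        have "\<not> (LEAST n. s n = p) \<ge> N"
        proof
          assume "(LEAST n. s n = p) \<ge> N"
          then have "w p \<le> inverse (real (Suc N))"
            using \<open>p \<noteq> x\<close> by (simp add: w_def)
          moreover have "w p \<ge> 0"
            by (simp add: w_def)
          ultimately show False
            using N e[of "w p"] p(2) by simp
        qed
        then show "p \<in> s ` {..N}"
          using least[OF p(1) \<open>p \<noteq> x\<close>] by (metis atMost_iff imageI linear)
      qed
      then have "finite ?T"
        by (rule finite_subset) simp
      then show ?thesis
        using X SX T by (intro closedin_Hausdorff_finite) auto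
    qed
    then show "closedin (subtopology X S) ?T"
      by (rule closedin_subset_topspace) (auto simp: T)
  qed simp
  moreover have "inj_on w (topspace (subtopology X S))"
  proof (rule inj_onI)
    fix p q
    assume p: "p \<in> topspace (subtopology X S)" and q: "q \<in> topspace (subtopology X S)"
      and eq: "w p = w q"
    show "p = q"
    proof (cases "p = x \<or> q = x")
      case True
      then show ?thesis
        using eq by (auto simp: w_def split: if_splits)
    next
      case False
      then have "(LEAST n. s n = p) = (LEAST n. s n = q)"
        using eq by (simp add: w_def)
      then show ?thesis
        using least[of p] least[of q] p q False by (metis Int_iff topspace_subtopology)
    qed
  qed
  moreover have "compact_space (subtopology X S)"
    using compactin_convergent_seq[OF assms(2)] by (rule compact_space_subtopology)
  ultimately have "embedding_map (subtopology X S) euclideanreal w"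
    by (intro continuous_imp_embedding_map) auto
  then show ?thesis
    using embedding_map_imp_homeomorphic_space homeomorphic_metrizable_space
      metrizable_space_subtopology metrizable_space_euclidean by metis
qed

section \<open>Properties of the sum of convergent sequences and of metrizable spaces\<close>

lemma metrizable_space_seq_sum:
  "Hausdorff_space X \<Longrightarrow> metrizable_space (seq_sum X)"
  unfolding seq_sum_def
  by (simp add: metrizable_space_sum_topology metrizable_space_convergent_seq)

lemma locally_compact_space_seq_sum:
  "locally_compact_space (seq_sum X)"
  unfolding seq_sum_def locally_compact_space_sum_topology
  by (simp add: compact_imp_locally_compact_space compact_space_subtopology compactin_convergent_seq)

lemma metrizable_imp_tychonoff_space:
  "metrizable_space X \<Longrightarrow> tychonoff_space X"
  by (simp add: tychonoff_space_def metrizable_imp_completely_regular_space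
      metrizable_imp_Hausdorff_space)

lemma metrizable_imp_Frechet_Urysohn_space:
  assumes "metrizable_space X"
  shows "Frechet_Urysohn_space X"
proof -
  obtain M d where "Metric_space M d" and X: "X = Metric_space.mtopology M d"
    using assms unfolding metrizable_space_def by blast
  then interpret Metric_space M d
    by simp
  show ?thesis
    unfolding Frechet_Urysohn_space_def X closure_of_sequentially by blast
qed

section \<open>The natural map from the sum\<close>

lemma convergent_seqsI:
  "\<lbrakk>range s \<subseteq> topspace X; limitin X s x sequentially\<rbrakk> \<Longrightarrow> insert x (range s) \<in> convergent_seqs X"
  unfolding convergent_seqs_def by blast

lemma convergent_seqs_subset_topspace:
  "S \<in> convergent_seqs X \<Longrightarrow> S \<subseteq> topspace X"
  by (simp add: compactin_convergent_seq compactin_subset_topspace)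

text \<open>Constant sequences make the natural map surjective.\<close>

lemma singleton_in_convergent_seqs:
  assumes "x \<in> topspace X"
  shows "{x} \<in> convergent_seqs X"
  using convergent_seqsI[of "\<lambda>_. x" X x] assms by simp

lemma topspace_seq_sum: "topspace (seq_sum X) = Sigma (convergent_seqs X) id"
  unfolding seq_sum_def using convergent_seqs_subset_topspace by fastforce

lemma continuous_map_seq_sum: "continuous_map (seq_sum X) X snd"
  unfolding continuous_map_def
proof (intro conjI allI impI)
  show "snd \<in> topspace (seq_sum X) \<rightarrow> topspace X"
    unfolding topspace_seq_sum using convergent_seqs_subset_topspace by fastforce
  fix U
  assume U: "openin X U"
  have "openin (subtopology X S) {x. (S, x) \<in> topspace (seq_sum X) \<and> x \<in> U}"
    if "S \<in> convergent_seqs X" for S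
  proof -
    \<comment> \<open>Openness in the sum is tested on each summand, where the preimage of
      \<open>U\<close> is its trace on \<open>S\<close>.\<close>
    have "{x. (S, x) \<in> topspace (seq_sum X) \<and> x \<in> U} = U \<inter> S"
      using that by (auto simp: topspace_seq_sum)
    then show ?thesis
      using U by (auto simp: openin_subtopology)
  qed
  moreover have "{p \<in> topspace (seq_sum X). snd p \<in> U}
      \<subseteq> Sigma (convergent_seqs X) (topspace \<circ> subtopology X)"
    unfolding topspace_seq_sum using convergent_seqs_subset_topspace by fastforce
  ultimately show "openin (seq_sum X) {p \<in> topspace (seq_sum X). snd p \<in> U}"
    by (simp add: seq_sum_def openin_sum_topology)
qed

lemma kappa_pseudo_open_map_seq_sum:
  assumes X: "kappa_Frechet_Urysohn_space X"
  shows "kappa_pseudo_open_map (seq_sum X) X snd"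
  unfolding kappa_pseudo_open_map_def
proof (intro conjI allI impI)
  show "continuous_map (seq_sum X) X snd"
    by (rule continuous_map_seq_sum)
  show "snd ` topspace (seq_sum X) = topspace X"
    unfolding topspace_seq_sum
    using convergent_seqs_subset_topspace singleton_in_convergent_seqs by force
  fix y U
  assume "y \<in> topspace X \<and> openin (seq_sum X) U \<and> {p \<in> topspace (seq_sum X). snd p = y} \<subseteq> U"
  then have y: "y \<in> topspace X" and U: "openin (seq_sum X) U"
    and fib: "{p \<in> topspace (seq_sum X). snd p = y} \<subseteq> U"
    by auto
  let ?V = "topspace X - X closure_of (snd ` U)"
  show "y \<in> X interior_of (X closure_of (snd ` U))"
  proof (rule ccontr)
    assume "y \<notin> X interior_of (X closure_of (snd ` U))"
    \<comment> \<open>The closure of a complement is the complement of the interior.\<close>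
    then have "y \<in> X closure_of ?V"
      using y by (simp add: closure_of_complement)
    moreover have "openin X ?V"
      by (simp add: openin_diff)
    ultimately obtain s where s: "range s \<subseteq> ?V" and lim: "limitin X s y sequentially"
      using X unfolding kappa_Frechet_Urysohn_space_def by blast
    define S where "S = insert y (range s)"
    have S: "S \<in> convergent_seqs X"
      unfolding S_def using s lim by (intro convergent_seqsI) auto
    \<comment> \<open>The set \<open>S\<close> contains all terms and the limit, so convergence
      takes place inside this summand. There the slice of \<open>U\<close> is an open neighbourhood
      of \<open>y\<close>, because \<open>(S, y)\<close> lies in the fibre over
      \<open>y\<close>.\<close>
    have "limitin (subtopology X S) s y sequentially"
      using lim by (auto simp: limitin_subtopology S_def)
    moreover have "openin (subtopology X S) {x. (S, x) \<in> U}"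
      using U S by (simp add: seq_sum_def openin_sum_topology)
    moreover have "(S, y) \<in> U"
      using fib S by (auto simp: topspace_seq_sum S_def)
    ultimately obtain n where "(S, s n) \<in> U"
      unfolding limitin_sequentially by blast
    then have "s n \<in> snd ` U"
      by force
    moreover have "snd ` U \<subseteq> X closure_of (snd ` U)"
      using image_mono[OF openin_subset[OF U], of snd]
        continuous_map_image_subset_topspace[OF continuous_map_seq_sum[of X]]
      by (intro closure_of_subset) (rule order_trans)
    ultimately have "s n \<in> X closure_of (snd ` U)"
      by (rule subsetD[rotated])
    moreover have "s n \<in> ?V"
      by (rule subsetD[OF s rangeI])
    ultimately show False
      by simp
  qed
qed

section \<open>Images of Frechet-Urysohn spaces\<close>

lemma kappa_Frechet_Urysohn_space_kappa_pseudo_open_image: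
  assumes Z: "Frechet_Urysohn_space Z" and f: "kappa_pseudo_open_map Z X f"
  shows "kappa_Frechet_Urysohn_space X"
  unfolding kappa_Frechet_Urysohn_space_def
proof (intro allI impI)
  fix U x
  assume "openin X U \<and> x \<in> X closure_of U"
  then have U: "openin X U" and x: "x \<in> X closure_of U"
    by auto
  have cont: "continuous_map Z X f"
    using f by (simp add: kappa_pseudo_open_map_def)
  have xX: "x \<in> topspace X"
    using x by (simp add: in_closure_of)
  show "\<exists>s :: nat \<Rightarrow> 'b. range s \<subseteq> U \<and> limitin X s x sequentially"
  \<comment> \<open>\<open>Frechet_Urysohn_space\<close> yields sequences only for points outside
    the given set. With \<open>x \<notin> U\<close>, every point of the fibre over \<open>x\<close>
    is outside \<open>A\<close>.\<close>
  proof (cases "x \<in> U")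
    case True
    then show ?thesis
      using xX by (intro exI[of _ "\<lambda>_. x"]) auto
  next
    case False
    define A where "A = {z \<in> topspace Z. f z \<in> U}"
    define W where "W = topspace Z - Z closure_of A"
    have "\<exists>z \<in> Z closure_of A. f z = x"
    proof (rule ccontr)
      assume "\<not> ?thesis"
      then have "{z \<in> topspace Z. f z = x} \<subseteq> W"
        by (auto simp: W_def)
      moreover have "openin Z W"
        unfolding W_def by (simp add: openin_diff)
      ultimately have x_int: "x \<in> X interior_of (X closure_of (f ` W))"
        using f xX unfolding kappa_pseudo_open_map_def by blast
      have "A \<subseteq> Z closure_of A"
        by (rule closure_of_subset) (auto simp: A_def)
      then have "U \<inter> f ` W = {}"
        by (auto simp: W_def A_def)
      then have "U \<inter> X closure_of (f ` W) = {}"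
        using U by (simp add: openin_Int_closure_of_eq_empty)
      then have "U \<inter> X interior_of (X closure_of (f ` W)) = {}"
        using interior_of_subset by fastforce
      moreover have "\<exists>y. y \<in> U \<and> y \<in> X interior_of (X closure_of (f ` W))"
        using x x_int openin_interior_of unfolding in_closure_of by blast
      ultimately show False
        by blast
    qed
    then obtain z where z: "z \<in> Z closure_of A" "f z = x"
      by blast
    have "z \<notin> A"
      using z False by (auto simp: A_def)
    then obtain s where s: "range s \<subseteq> A" "limitin Z s z sequentially"
      using Z z unfolding Frechet_Urysohn_space_def
      by (metis (no_types, lifting) A_def Diff_iff mem_Collect_eq subsetI)
    have "range (f \<circ> s) \<subseteq> U"
      using s(1) by (auto simp: A_def)
    moreover have "limitin X (f \<circ> s) x sequentially"
      using continuous_map_limit[OF cont s(2)] z(2) by simp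
    ultimately show ?thesis
      by blast
  qed
qed

text \<open>A formula of HOL cannot quantify over spaces of every type. The equivalences therefore
  place \<open>Z\<close> on the point type of \<open>seq_sum X\<close>, where the witness lives, and
  the last two conjuncts give the converse implications for \<open>Z\<close> on an arbitrary type
  \<open>'b\<close>.\<close>

theorem theorem5p4:
  fixes X :: "'a topology"
  assumes "tychonoff_space X"
  shows
    "(kappa_Frechet_Urysohn_space X \<longleftrightarrow> kappa_pseudo_open_map (seq_sum X) X snd) \<and>
     (kappa_Frechet_Urysohn_space X \<longleftrightarrow>
        (\<exists>(Z :: ('a set \<times> 'a) topology) f.
           metrizable_space Z \<and> locally_compact_space Z \<and> kappa_pseudo_open_map Z X f)) \<and>
     (kappa_Frechet_Urysohn_space X \<longleftrightarrow>
        (\<exists>(Z :: ('a set \<times> 'a) topology) f.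
           tychonoff_space Z \<and> Frechet_Urysohn_space Z \<and> kappa_pseudo_open_map Z X f)) \<and>
     ((\<exists>(Z :: 'b topology) f.
         metrizable_space Z \<and> locally_compact_space Z \<and> kappa_pseudo_open_map Z X f)
        \<longrightarrow> kappa_Frechet_Urysohn_space X) \<and>
     ((\<exists>(Z :: 'b topology) f.
         tychonoff_space Z \<and> Frechet_Urysohn_space Z \<and> kappa_pseudo_open_map Z X f)
        \<longrightarrow> kappa_Frechet_Urysohn_space X)"
proof -
  let ?\<Sigma> = "seq_sum X"
  let ?\<kappa>FU = "kappa_Frechet_Urysohn_space X"
  have "Hausdorff_space X"
    using assms by (simp add: tychonoff_space_def)
  then have met: "metrizable_space ?\<Sigma>"
    by (rule metrizable_space_seq_sum)
  note loc = locally_compact_space_seq_sum[of X]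
    and tych = metrizable_imp_tychonoff_space[OF met]
    and FU = metrizable_imp_Frechet_Urysohn_space[OF met]
  note image = kappa_Frechet_Urysohn_space_kappa_pseudo_open_image
  note metrizable_image = image[OF metrizable_imp_Frechet_Urysohn_space]
  show ?thesis
  proof (intro conjI iffI impI)
    assume ?\<kappa>FU
    then show I: "kappa_pseudo_open_map ?\<Sigma> X snd"
      by (rule kappa_pseudo_open_map_seq_sum)
    \<comment> \<open>The sum with the map \<open>snd\<close> is the witness for both existential
      statements.\<close>
    show "\<exists>(Z :: ('a set \<times> 'a) topology) f.
        metrizable_space Z \<and> locally_compact_space Z \<and> kappa_pseudo_open_map Z X f"
      using met loc I by (intro exI conjI)
    show "\<exists>(Z :: ('a set \<times> 'a) topology) f.
        tychonoff_space Z \<and> Frechet_Urysohn_space Z \<and> kappa_pseudo_open_map Z X f"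
      using tych FU I by (intro exI conjI)
  next
    assume "kappa_pseudo_open_map ?\<Sigma> X snd"
    then show ?\<kappa>FU
      by (rule image[OF FU])
  next
    assume "\<exists>(Z :: ('a set \<times> 'a) topology) f.
        metrizable_space Z \<and> locally_compact_space Z \<and> kappa_pseudo_open_map Z X f"
    then show ?\<kappa>FU
      by (elim exE conjE) (rule metrizable_image)
  next
    assume "\<exists>(Z :: ('a set \<times> 'a) topology) f.
        tychonoff_space Z \<and> Frechet_Urysohn_space Z \<and> kappa_pseudo_open_map Z X f"
    then show ?\<kappa>FU
      by (elim exE conjE) (rule image)
  next
    assume "\<exists>(Z :: 'b topology) f.
        metrizable_space Z \<and> locally_compact_space Z \<and> kappa_pseudo_open_map Z X f"
    then show ?\<kappa>FU
      by (elim exE conjE) (rule metrizable_image)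
  next
    assume "\<exists>(Z :: 'b topology) f.
        tychonoff_space Z \<and> Frechet_Urysohn_space Z \<and> kappa_pseudo_open_map Z X f"
    then show ?\<kappa>FU
      by (elim exE conjE) (rule image)
  qed
qed

end
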